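(* Let $k$ be a field and let $H$ be the bosonization of the superline over $k$. Then the first adjoint cohomology of $H$ is given by $H^1_{\mathrm{ad}}(H,H)\cong k$.
   Context: The bosonization of the superline is the Hopf algebra $H$ over $k$ (with basis $1,g,x,gx$) generated by $1,g,x$ with relations $x^2=0$, $g^2=1$, $xg=-gx$ and Hopf algebra structure $\Delta(x)=x\otimes 1+g\otimes x$, $\Delta(g)=g\otimes g$, $\epsilon(x)=0$, $\epsilon(g)=1$, $S(x)=-gx$, $S(g)=g$. For a Hopf algebra $H$ with multiplication $\mu$, comultiplication $\Delta$, antipode $S$, and Sweedler notation $\Delta(y)=y_{(1)}\otimes y_{(2)}$, the adjoint map is $\mathrm{ad}(a\otimes y)=S(y_{(1)})\,a\,y_{(2)}$. In formulas for maps, $1$ denotes the identity map. Put $C^1_{\mathrm{ad}}(H;H)=\{f\in \mathrm{Hom}_k(H,H) : f\mu=\mu(f\otimes 1)+\mu(1\otimes f),\ \Delta f=(f\otimes 1)\Delta+(1\otimes f)\Delta\}$ and define $D_1:C^1_{\mathrm{ad}}(H;H)\to\mathrm{Hom}(H\otimes H,H)$ by $D_1(f)=\mathrm{ad}(1\otimes f)-f\,\mathrm{ad}+\mathrm{ad}(f\otimes 1)$. With $C^0(H;H)=0$ and $D_0=0$, the first adjoint cohomology group is $H^1_{\mathrm{ad}}(H,H)=\ker D_1/\mathrm{Image}\,D_0=\ker D_1$.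
   Formalization: The field k is assumed to have characteristic different from 2; in characteristic 2 the claim fails, since x ↦ 1−g, gx ↦ g−1 (with 1, g ↦ 0) gives a second independent class in the first adjoint cohomology. *)

theory Defs
  imports "HOL-Analysis.Analysis" "HOL-Library.Function_Algebras"
begin

section \<open>Tensor products of coordinate spaces\<close>

text \<open>
  A finite-dimensional vector space with a chosen basis indexed by \<open>'b\<close> is \<open>'k ^ 'b\<close>, with basis
  vectors \<open>axis i 1\<close>. The tensor product of \<open>'k ^ 'a\<close> and \<open>'k ^ 'b\<close> is \<open>'k ^ ('a \<times> 'b)\<close>, and the
  basis vector at \<open>(i, j)\<close> is the tensor of the basis vectors at \<open>i\<close> and \<open>j\<close>.
\<close>

definition tens :: "'k::field ^ 'a \<Rightarrow> 'k ^ 'b \<Rightarrow> 'k ^ ('a \<times> 'b)"  (infixr \<open>\<otimes>\<^sub>v\<close> 72)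
  where "u \<otimes>\<^sub>v v = (\<chi> ij. u $ fst ij * v $ snd ij)"

text \<open>
  \<open>tlift B\<close> is the linear map on the tensor product induced by a bilinear map \<open>B\<close>. In particular,
  \<open>tlift (\<lambda>y1 y2. B y1 y2) (\<Delta> y)\<close> is what Sweedler notation writes as \<open>B y1 y2\<close>.
\<close>

definition tlift :: "('k::field ^ 'a \<Rightarrow> 'k ^ 'b \<Rightarrow> 'k ^ 'c) \<Rightarrow> 'k ^ ('a \<times> 'b) \<Rightarrow> 'k ^ 'c"
  where "tlift B t = (\<Sum>i\<in>UNIV. \<Sum>j\<in>UNIV. t $ (i, j) *s B (axis i 1) (axis j 1))"

definition tmap :: "('k::field ^ 'a \<Rightarrow> 'k ^ 'c) \<Rightarrow> ('k ^ 'b \<Rightarrow> 'k ^ 'd) \<Rightarrow>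
    'k ^ ('a \<times> 'b) \<Rightarrow> 'k ^ ('c \<times> 'd)"
  where "tmap f g = tlift (\<lambda>u v. f u \<otimes>\<^sub>v g v)"

definition tassoc :: "'k::field ^ (('a::finite \<times> 'b::finite) \<times> 'c::finite) \<Rightarrow> 'k ^ ('a \<times> 'b \<times> 'c)"
  where "tassoc t = (\<chi> ijl. t $ ((fst ijl, fst (snd ijl)), snd (snd ijl)))"

lemma linear_basis_expansion:
  assumes "Vector_Spaces.linear (*s) (*s) (f :: 'k::field ^ 'a \<Rightarrow> 'k ^ 'b)"
  shows "f u = (\<Sum>i\<in>UNIV. u $ i *s f (axis i 1))"
proof -
  interpret f: Vector_Spaces.linear "(*s)" "(*s)" f by (rule assms)
  have "f u = f (\<Sum>i\<in>UNIV. u $ i *s axis i 1)" by (simp add: basis_expansion)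
  also have "\<dots> = (\<Sum>i\<in>UNIV. u $ i *s f (axis i 1))" by (simp add: f.sum f.scale)
  finally show ?thesis .
qed

lemma tlift_tens:
  fixes B :: "'k::field ^ 'a \<Rightarrow> 'k ^ 'b \<Rightarrow> 'k ^ 'c"
  assumes "\<And>u. Vector_Spaces.linear (*s) (*s) (B u)"
    and "\<And>v. Vector_Spaces.linear (*s) (*s) (\<lambda>u. B u v)"
  shows "tlift B (u \<otimes>\<^sub>v v) = B u v"
proof -
  have "B u v = (\<Sum>i\<in>UNIV. u $ i *s B (axis i 1) v)"
    using linear_basis_expansion[OF assms(2)] .
  also have "\<dots> = (\<Sum>i\<in>UNIV. u $ i *s (\<Sum>j\<in>UNIV. v $ j *s B (axis i 1) (axis j 1)))"
    by (subst linear_basis_expansion[OF assms(1)]) simp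
  also have "\<dots> = tlift B (u \<otimes>\<^sub>v v)"
    by (simp add: tlift_def tens_def vec_eq_iff sum_distrib_left mult.assoc)
  finally show ?thesis by simp
qed

lemma linear_tlift: "Vector_Spaces.linear (*s) (*s) (tlift B)"
  unfolding Vector_Spaces.linear_iff tlift_def
  by (auto simp: vec.vector_space_axioms vec.scale_sum_right vec.scale_left_distrib sum.distrib)

lemma linear_tens_left: "Vector_Spaces.linear (*s) (*s) (\<lambda>u. u \<otimes>\<^sub>v v)"
  and linear_tens_right: "Vector_Spaces.linear (*s) (*s) (\<lambda>v. u \<otimes>\<^sub>v v)"
  unfolding Vector_Spaces.linear_iff tens_def
  by (auto simp: vec.vector_space_axioms vec_eq_iff algebra_simps)

lemma tmap_tens:
  assumes "Vector_Spaces.linear (*s) (*s) f" "Vector_Spaces.linear (*s) (*s) g"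
  shows "tmap f g (u \<otimes>\<^sub>v v) = f u \<otimes>\<^sub>v g v"
  unfolding tmap_def
  using Vector_Spaces.linear_compose[OF assms(2) linear_tens_right]
    Vector_Spaces.linear_compose[OF assms(1) linear_tens_left]
  by (subst tlift_tens) (auto simp: o_def)


section \<open>Hopf algebras\<close>

record ('k, 'b) hopf =
  hmult :: "'k ^ ('b \<times> 'b) \<Rightarrow> 'k ^ 'b"
  hunit :: "'k ^ 'b"
  hcomult :: "'k ^ 'b \<Rightarrow> 'k ^ ('b \<times> 'b)"
  hcounit :: "'k ^ 'b \<Rightarrow> 'k"
  hantipode :: "'k ^ 'b \<Rightarrow> 'k ^ 'b"

definition hprod :: "('k::field, 'b::finite) hopf \<Rightarrow> 'k ^ 'b \<Rightarrow> 'k ^ 'b \<Rightarrow> 'k ^ 'b"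
  where "hprod H a b = hmult H (a \<otimes>\<^sub>v b)"

definition hprod2 :: "('k::field, 'b::finite) hopf \<Rightarrow> 'k ^ ('b \<times> 'b) \<Rightarrow> 'k ^ ('b \<times> 'b) \<Rightarrow>
    'k ^ ('b \<times> 'b)"
  where "hprod2 H s t =
    tlift (\<lambda>a b. tlift (\<lambda>c d. hprod H a c \<otimes>\<^sub>v hprod H b d) t) s"

definition hopf_algebra :: "('k::field, 'b::finite) hopf \<Rightarrow> bool"
  where "hopf_algebra H \<longleftrightarrow>
    Vector_Spaces.linear (*s) (*s) (hmult H) \<and>
    Vector_Spaces.linear (*s) (*s) (hcomult H) \<and>
    Vector_Spaces.linear (*s) (*) (hcounit H) \<and>
    Vector_Spaces.linear (*s) (*s) (hantipode H) \<and>
    (\<forall>a b c. hprod H (hprod H a b) c = hprod H a (hprod H b c)) \<and>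
    (\<forall>a. hprod H (hunit H) a = a \<and> hprod H a (hunit H) = a) \<and>
    (\<forall>y. tassoc (tmap (hcomult H) id (hcomult H y)) = tmap id (hcomult H) (hcomult H y)) \<and>
    (\<forall>y. tlift (\<lambda>y1 y2. hcounit H y1 *s y2) (hcomult H y) = y \<and>
         tlift (\<lambda>y1 y2. hcounit H y2 *s y1) (hcomult H y) = y) \<and>
    hcomult H (hunit H) = hunit H \<otimes>\<^sub>v hunit H \<and>
    (\<forall>a b. hcomult H (hprod H a b) = hprod2 H (hcomult H a) (hcomult H b)) \<and>
    hcounit H (hunit H) = 1 \<and>
    (\<forall>a b. hcounit H (hprod H a b) = hcounit H a * hcounit H b) \<and>
    (\<forall>y. tlift (\<lambda>y1 y2. hprod H (hantipode H y1) y2) (hcomult H y) = hcounit H y *s hunit H \<and>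
         tlift (\<lambda>y1 y2. hprod H y1 (hantipode H y2)) (hcomult H y) = hcounit H y *s hunit H)"


section \<open>First adjoint cohomology\<close>

definition ad :: "('k::field, 'b::finite) hopf \<Rightarrow> 'k ^ ('b \<times> 'b) \<Rightarrow> 'k ^ 'b"
  where "ad H = tlift (\<lambda>a y. tlift (\<lambda>y1 y2. hprod H (hprod H (hantipode H y1) a) y2) (hcomult H y))"

definition C1_ad :: "('k::field, 'b::finite) hopf \<Rightarrow> ('k ^ 'b \<Rightarrow> 'k ^ 'b) set"
  where "C1_ad H = {f. Vector_Spaces.linear (*s) (*s) f \<and>
    f \<circ> hmult H = (hmult H \<circ> tmap f id) + (hmult H \<circ> tmap id f) \<and>
    hcomult H \<circ> f = (tmap f id \<circ> hcomult H) + (tmap id f \<circ> hcomult H)}"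

definition D1 :: "('k::field, 'b::finite) hopf \<Rightarrow> ('k ^ 'b \<Rightarrow> 'k ^ 'b) \<Rightarrow> 'k ^ ('b \<times> 'b) \<Rightarrow> 'k ^ 'b"
  where "D1 H f = (ad H \<circ> tmap id f) - (f \<circ> ad H) + (ad H \<circ> tmap f id)"

text \<open>There are no coboundaries, since \<open>C\<^sup>0 = 0\<close>; so the cohomology is the kernel of \<open>D1\<close>.\<close>

definition H1_ad :: "('k::field, 'b::finite) hopf \<Rightarrow> ('k ^ 'b \<Rightarrow> 'k ^ 'b) set"
  where "H1_ad H = {f \<in> C1_ad H. D1 H f = 0}"

definition hom_scale :: "'k::field \<Rightarrow> ('c \<Rightarrow> 'k ^ 'b) \<Rightarrow> 'c \<Rightarrow> 'k ^ 'b"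
  where "hom_scale c f = (\<lambda>v. c *s f v)"

definition vs_iso_on :: "('k \<Rightarrow> 'u \<Rightarrow> 'u) \<Rightarrow> 'u::ab_group_add set \<Rightarrow>
    ('k \<Rightarrow> 'w \<Rightarrow> 'w) \<Rightarrow> 'w::ab_group_add set \<Rightarrow> bool"
  where "vs_iso_on s V s' W \<longleftrightarrow> (\<exists>\<phi>. bij_betw \<phi> V W \<and>
    (\<forall>u\<in>V. \<forall>v\<in>V. \<phi> (u + v) = \<phi> u + \<phi> v) \<and>
    (\<forall>c. \<forall>v\<in>V. \<phi> (s c v) = s' c (\<phi> v)))"

lemma tmap_add_left: "tmap (f + f') g = tmap f g + tmap f' g"
  and tmap_add_right: "tmap g (f + f') = tmap g f + tmap g f'"
  and tmap_scale_left: "tmap (hom_scale c f) g = hom_scale c (tmap f g)"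
  and tmap_scale_right: "tmap g (hom_scale c f) = hom_scale c (tmap g f)"
  by (auto simp: fun_eq_iff tmap_def tlift_def tens_def hom_scale_def vec_eq_iff sum.distrib
      sum_distrib_left algebra_simps)

lemma vector_space_hom_scale: "vector_space (hom_scale :: 'k::field \<Rightarrow> ('c \<Rightarrow> 'k ^ 'b) \<Rightarrow> _)"
  by unfold_locales (auto simp: hom_scale_def fun_eq_iff vec_eq_iff algebra_simps)

lemma subspace_H1_ad:
  assumes "hopf_algebra H"
  shows "module.subspace hom_scale (H1_ad H)"
proof -
  interpret V: vector_space "hom_scale :: 'a \<Rightarrow> ('a ^ 'b \<Rightarrow> 'a ^ 'b) \<Rightarrow> _"
    by (rule vector_space_hom_scale)
  interpret m: Vector_Spaces.linear "(*s)" "(*s)" "hmult H"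
    using assms by (simp add: hopf_algebra_def)
  interpret d: Vector_Spaces.linear "(*s)" "(*s)" "hcomult H"
    using assms by (simp add: hopf_algebra_def)
  interpret ad: Vector_Spaces.linear "(*s)" "(*s)" "ad H"
    unfolding ad_def by (rule linear_tlift)
  have 0: "tmap 0 g = 0" "tmap g 0 = 0" for g :: "'a ^ 'b \<Rightarrow> 'a ^ 'b"
    by (auto simp: fun_eq_iff tmap_def tlift_def tens_def vec_eq_iff)
  show ?thesis
    unfolding V.subspace_def H1_ad_def C1_ad_def D1_def Vector_Spaces.linear_iff
    by (auto simp: fun_eq_iff 0 tmap_add_left tmap_add_right tmap_scale_left tmap_scale_right
        m.add d.add ad.add m.zero d.zero ad.zero algebra_simps vec.vector_space_axioms)
      (auto simp: hom_scale_def m.scale d.scale ad.scale algebra_simps vec.scale_left_commute,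
        metis vec.scale_right_distrib)
qed


section \<open>The bosonization of the superline\<close>

text \<open>The indices \<open>B1\<close>, \<open>BG\<close>, \<open>BX\<close>, \<open>BGX\<close> stand for the basis \<open>1\<close>, \<open>g\<close>, \<open>x\<close>, \<open>gx\<close>.\<close>

datatype sbasis = B1 | BG | BX | BGX

lemma UNIV_sbasis: "UNIV = {B1, BG, BX, BGX}"
  using sbasis.exhaust by auto

instance sbasis :: finite
  by standard (simp add: UNIV_sbasis)

text \<open>
  The product of two basis elements is rewritten with \<open>x\<^sup>2 = 0\<close>, \<open>g\<^sup>2 = 1\<close>, \<open>xg = - gx\<close>; the values of
  the comultiplication, counit and antipode on \<open>gx\<close> are forced by multiplicativity and
  antimultiplicativity.
\<close>

fun sl_mult :: "sbasis \<Rightarrow> sbasis \<Rightarrow> 'k::field ^ sbasis" where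
  "sl_mult B1 j = axis j 1"
| "sl_mult i B1 = axis i 1"
| "sl_mult BG BG = axis B1 1"
| "sl_mult BG BX = axis BGX 1"
| "sl_mult BG BGX = axis BX 1"
| "sl_mult BX BG = - axis BGX 1"
| "sl_mult BGX BG = - axis BX 1"
| "sl_mult BX BX = 0"
| "sl_mult BX BGX = 0"
| "sl_mult BGX BX = 0"
| "sl_mult BGX BGX = 0"

fun sl_comult :: "sbasis \<Rightarrow> 'k::field ^ (sbasis \<times> sbasis)" where
  "sl_comult B1 = axis B1 1 \<otimes>\<^sub>v axis B1 1"
| "sl_comult BG = axis BG 1 \<otimes>\<^sub>v axis BG 1"
| "sl_comult BX = axis BX 1 \<otimes>\<^sub>v axis B1 1 + axis BG 1 \<otimes>\<^sub>v axis BX 1"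
| "sl_comult BGX = axis BGX 1 \<otimes>\<^sub>v axis BG 1 + axis B1 1 \<otimes>\<^sub>v axis BGX 1"

fun sl_counit :: "sbasis \<Rightarrow> 'k::field" where
  "sl_counit B1 = 1"
| "sl_counit BG = 1"
| "sl_counit BX = 0"
| "sl_counit BGX = 0"

fun sl_antipode :: "sbasis \<Rightarrow> 'k::field ^ sbasis" where
  "sl_antipode B1 = axis B1 1"
| "sl_antipode BG = axis BG 1"
| "sl_antipode BX = - axis BGX 1"
| "sl_antipode BGX = axis BX 1"

definition superline :: "('k::field, sbasis) hopf" where
  "superline = \<lparr>
    hmult = (\<lambda>t. \<Sum>i\<in>UNIV. \<Sum>j\<in>UNIV. t $ (i, j) *s sl_mult i j),
    hunit = axis B1 1,
    hcomult = (\<lambda>v. \<Sum>i\<in>UNIV. v $ i *s sl_comult i),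
    hcounit = (\<lambda>v. \<Sum>i\<in>UNIV. v $ i * sl_counit i),
    hantipode = (\<lambda>v. \<Sum>i\<in>UNIV. v $ i *s sl_antipode i)\<rparr>"

abbreviation sl_one :: "'k::field ^ sbasis" where "sl_one \<equiv> axis B1 1"
abbreviation sl_g :: "'k::field ^ sbasis" where "sl_g \<equiv> axis BG 1"
abbreviation sl_x :: "'k::field ^ sbasis" where "sl_x \<equiv> axis BX 1"
abbreviation sl_gx :: "'k::field ^ sbasis" where "sl_gx \<equiv> axis BGX 1"

lemma sum_sbasis: "(\<Sum>i\<in>UNIV. f i) = f B1 + f BG + f BX + f BGX"
  for f :: "sbasis \<Rightarrow> 'c::comm_monoid_add"
  by (simp add: UNIV_sbasis add.assoc)

lemma all_sbasis: "(\<forall>i. P i) \<longleftrightarrow> P B1 \<and> P BG \<and> P BX \<and> P BGX"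
  by (metis sbasis.exhaust)

lemma axis_nth: "axis i a $ j = (if j = i then a else 0)"
  by (simp add: axis_def)

lemma superline_mult_axis: "hprod superline (axis i 1) (axis j 1) = sl_mult i j"
  by (cases i; cases j)
    (simp_all add: superline_def hprod_def tens_def axis_nth sum_sbasis vec_eq_iff all_sbasis)

lemma superline_comult_axis: "hcomult superline (axis i 1) = sl_comult i"
  by (cases i) (simp_all add: superline_def axis_nth sum_sbasis)

lemma superline_counit_axis: "hcounit superline (axis i 1) = sl_counit i"
  by (cases i) (simp_all add: superline_def axis_nth sum_sbasis)

lemma superline_antipode_axis: "hantipode superline (axis i 1) = sl_antipode i"
  by (cases i) (simp_all add: superline_def axis_nth sum_sbasis)

lemmas superline_axis =
  superline_mult_axis superline_comult_axis superline_counit_axis superline_antipode_axis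

lemma superline_relations:
  "hunit superline = sl_one"
  "hprod superline sl_g sl_x = sl_gx"
  "hprod superline sl_x sl_x = 0"
  "hprod superline sl_g sl_g = sl_one"
  "hprod superline sl_x sl_g = - hprod superline sl_g sl_x"
  "hcomult superline sl_x = sl_x \<otimes>\<^sub>v sl_one + sl_g \<otimes>\<^sub>v sl_x"
  "hcomult superline sl_g = sl_g \<otimes>\<^sub>v sl_g"
  "hcounit superline sl_x = 0"
  "hcounit superline sl_g = 1"
  "hantipode superline sl_x = - hprod superline sl_g sl_x"
  "hantipode superline sl_g = sl_g"
  by (simp_all add: superline_axis) (simp add: superline_def)

lemma superline_linear:
  "Vector_Spaces.linear (*s) (*s) (hmult superline)"
  "Vector_Spaces.linear (*s) (*s) (hcomult superline)"
  "Vector_Spaces.linear (*s) (*) (hcounit superline)"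
  "Vector_Spaces.linear (*s) (*s) (hantipode superline)"
  unfolding Vector_Spaces.linear_iff superline_def
  by (auto simp: vec.vector_space_axioms vec_eq_iff sum.distrib sum_distrib_left algebra_simps
      intro: vector_space_over_itself.vector_space_axioms)

lemma superline_prod_nth:
  "hprod superline a b $ B1 = a $ B1 * b $ B1 + a $ BG * b $ BG"
  "hprod superline a b $ BG = a $ B1 * b $ BG + a $ BG * b $ B1"
  "hprod superline a b $ BX = a $ B1 * b $ BX + a $ BX * b $ B1 + a $ BG * b $ BGX - a $ BGX * b $ BG"
  "hprod superline a b $ BGX = a $ B1 * b $ BGX + a $ BGX * b $ B1 + a $ BG * b $ BX - a $ BX * b $ BG"
  by (simp_all add: superline_def hprod_def tens_def axis_nth sum_sbasis algebra_simps)

lemma superline_hopf_algebra: "hopf_algebra (superline :: ('k::field, sbasis) hopf)"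
proof -
  let ?H = "superline :: ('k, sbasis) hopf"
  have co: "hcomult ?H y $ (i, j) = (\<Sum>l\<in>UNIV. y $ l * sl_comult l $ (i, j))" for y i j
    by (simp add: superline_def)
  have eps: "hcounit ?H y = y $ B1 + y $ BG" for y
    by (simp add: superline_def sum_sbasis)
  have assoc: "hprod ?H (hprod ?H a b) c = hprod ?H a (hprod ?H b c)" for a b c
    by (simp add: vec_eq_iff all_sbasis superline_prod_nth algebra_simps)
  have unit: "hprod ?H (hunit ?H) a = a \<and> hprod ?H a (hunit ?H) = a" for a
    by (simp add: vec_eq_iff all_sbasis superline_prod_nth superline_relations axis_nth)
  have coassoc: "tassoc (tmap (hcomult ?H) id (hcomult ?H y)) = tmap id (hcomult ?H) (hcomult ?H y)" for y
    by (simp add: vec_eq_iff split_paired_all all_sbasis tassoc_def tmap_def tlift_def co sum_sbasis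
        superline_axis tens_def axis_nth)
  have counit: "tlift (\<lambda>y1 y2. hcounit ?H y1 *s y2) (hcomult ?H y) = y \<and>
         tlift (\<lambda>y1 y2. hcounit ?H y2 *s y1) (hcomult ?H y) = y" for y
    by (simp add: vec_eq_iff all_sbasis tlift_def co sum_sbasis superline_axis tens_def axis_nth)
  have anti: "tlift (\<lambda>y1 y2. hprod ?H (hantipode ?H y1) y2) (hcomult ?H y) = hcounit ?H y *s hunit ?H \<and>
         tlift (\<lambda>y1 y2. hprod ?H y1 (hantipode ?H y2)) (hcomult ?H y) = hcounit ?H y *s hunit ?H" for y
    by (simp add: vec_eq_iff all_sbasis tlift_def co sum_sbasis superline_antipode_axis tens_def axis_nth
      superline_prod_nth eps superline_relations(1))
  have com: "hcomult ?H (hprod ?H a b) = hprod2 ?H (hcomult ?H a) (hcomult ?H b)" for a b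
    by (simp add: vec_eq_iff split_paired_all all_sbasis hprod2_def tlift_def co sum_sbasis
        superline_mult_axis superline_prod_nth tens_def axis_nth algebra_simps)
  have cou: "hcounit ?H (hprod ?H a b) = hcounit ?H a * hcounit ?H b" for a b
    by (simp add: eps superline_prod_nth algebra_simps)
  show ?thesis
    unfolding hopf_algebra_def
    by (intro conjI allI superline_linear assoc com cou)
      (use unit coassoc counit anti in \<open>auto simp: superline_relations(1) superline_axis\<close>)
qed

text \<open>
  In characteristic 2 these formulas still define a Hopf algebra, but the map \<open>x \<mapsto> 1 - g\<close>,
  \<open>gx \<mapsto> g - 1\<close> is a second, linearly independent class, so that the first adjoint cohomology is
  not one-dimensional. The bosonization of a super-algebra assumes characteristic different from 2.
\<close>

lemma superline_H1_ad_char2: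
  assumes two: "(2::'k::field) = 0"
  shows "\<not> vs_iso_on hom_scale (H1_ad (superline :: ('k, sbasis) hopf)) (*) (UNIV :: 'k set)"
proof
  let ?H = "superline :: ('k, sbasis) hopf"
  assume "vs_iso_on hom_scale (H1_ad ?H) (*) (UNIV :: 'k set)"
  then obtain \<phi> where bij: "bij_betw \<phi> (H1_ad ?H) UNIV"
    and scale: "\<And>c v. v \<in> H1_ad ?H \<Longrightarrow> \<phi> (hom_scale c v) = c * \<phi> v"
    unfolding vs_iso_on_def by blast
  define f where "f a b v = v $ BX *s (a *s sl_x + b *s (sl_one - sl_g)) +
      v $ BGX *s (a *s sl_gx + b *s (sl_g - sl_one))" for a b :: 'k and v :: "'k ^ sbasis"
  have neg: "- c = (c :: 'k)" for c
    using two by (metis add_eq_0_iff mult_2 mult_zero_left)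
  have nth: "f a b v $ B1 = b * v $ BX + b * v $ BGX" "f a b v $ BG = b * v $ BX + b * v $ BGX"
    "f a b v $ BX = a * v $ BX" "f a b v $ BGX = a * v $ BGX" for a b v
    by (simp_all add: f_def axis_nth neg)
  have co: "hcomult ?H y $ (i, j) = (\<Sum>l\<in>UNIV. y $ l * sl_comult l $ (i, j))" for y i j
    by (simp add: superline_def)
  have m: "hmult ?H t $ B1 = t $ (B1, B1) + t $ (BG, BG)"
     "hmult ?H t $ BG = t $ (B1, BG) + t $ (BG, B1)"
     "hmult ?H t $ BX = t $ (B1, BX) + t $ (BX, B1) + t $ (BG, BGX) + t $ (BGX, BG)"
     "hmult ?H t $ BGX = t $ (B1, BGX) + t $ (BGX, B1) + t $ (BG, BX) + t $ (BX, BG)" for t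
    by (simp_all add: superline_def sum_sbasis axis_nth neg two algebra_simps)
  have cancel: "c + (c + d) = d" "c + c = 0" for c d :: 'k
    by (metis add.assoc add.left_neutral neg add.right_inverse)
      (metis neg add.right_inverse)
  have ad_nth: "ad ?H t $ l = t $ (l, B1) + t $ (l, BG)" for t l
    by (cases l) (simp_all add: ad_def tlift_def sum_sbasis superline_axis superline_prod_nth
       tens_def axis_nth neg cancel two algebra_simps)
  have mem: "f a b \<in> H1_ad ?H" for a b
    unfolding H1_ad_def C1_ad_def D1_def
    by (auto simp: Vector_Spaces.linear_iff vec.vector_space_axioms fun_eq_iff vec_eq_iff
        split_paired_all all_sbasis nth co m ad_nth tmap_def tlift_def sum_sbasis tens_def axis_nth
        neg cancel two algebra_simps)
  have ne: "f a b \<noteq> f c d" if "(a, b) \<noteq> (c, d)" for a b c d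
  proof
    assume "f a b = f c d"
    then have "f a b sl_x $ BX = f c d sl_x $ BX" "f a b sl_x $ B1 = f c d sl_x $ B1" by simp_all
    with that show False by (simp add: nth axis_nth)
  qed
  have sc: "hom_scale c (f a b) = f (c * a) (c * b)" for a b c
    by (simp add: hom_scale_def fun_eq_iff vec_eq_iff all_sbasis nth algebra_simps)
  have eq: "f (\<phi> (f 0 1)) 0 = f 0 (\<phi> (f 1 0))"
  proof -
    have "\<phi> (f (\<phi> (f 0 1)) 0) = \<phi> (f 0 (\<phi> (f 1 0)))"
      using scale[OF mem, of "\<phi> (f 0 1)" 1 0] scale[OF mem, of "\<phi> (f 1 0)" 0 1]
      by (simp add: sc)
    then show ?thesis
      using bij mem by (meson bij_betw_imp_inj_on inj_onD)
  qed
  then have "\<phi> (f 0 1) = \<phi> (f 1 0)"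
    using ne by (metis prod.inject)
  then have "f 0 1 = f 1 0"
    using bij mem by (meson bij_betw_imp_inj_on inj_onD)
  then show False
    using ne[of 0 1 1 0] by simp
qed

end

theory Submission
  imports Defs
begin

text \<open>
  A biderivation kills \<open>1\<close> and \<open>g\<close> because they are grouplike, and it sends the skew-primitive
  \<open>x\<close> to a skew-primitive \<open>a x + b (1 - g)\<close>. Applying the Leibniz rule to both sides of
  \<open>xg = - gx\<close> gives \<open>2 b = 0\<close>, so only the scaling of the odd part by \<open>a\<close> survives; each such
  scaling is a cocycle.
\<close>

definition odd_scaling :: "'k::field \<Rightarrow> 'k ^ sbasis \<Rightarrow> 'k ^ sbasis"
  where "odd_scaling a v = (a * v $ BX) *s sl_x + (a * v $ BGX) *s sl_gx"

lemma odd_scaling_nth [simp]: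
  "odd_scaling a v $ B1 = 0" "odd_scaling a v $ BG = 0"
  "odd_scaling a v $ BX = a * v $ BX" "odd_scaling a v $ BGX = a * v $ BGX"
  by (simp_all add: odd_scaling_def axis_nth)

lemma superline_comult_nth:
  "hcomult superline y $ (i, j) = (\<Sum>l\<in>UNIV. y $ l * sl_comult l $ (i, j))"
  by (simp add: superline_def)

text \<open>Stated for arbitrary tensors, since the derivation identity in \<open>C1_ad\<close>
  equates maps on the whole tensor square.\<close>

lemma superline_mult_nth:
  "hmult superline t $ B1 = t $ (B1, B1) + t $ (BG, BG)"
  "hmult superline t $ BG = t $ (B1, BG) + t $ (BG, B1)"
  "hmult superline t $ BX = t $ (B1, BX) + t $ (BX, B1) + t $ (BG, BGX) - t $ (BGX, BG)"
  "hmult superline t $ BGX = t $ (B1, BGX) + t $ (BGX, B1) + t $ (BG, BX) - t $ (BX, BG)"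
  by (simp_all add: superline_def sum_sbasis axis_nth algebra_simps)

lemma C1_ad_derivation:
  assumes "f \<in> C1_ad H"
  shows "f (hprod H a b) = hprod H (f a) b + hprod H a (f b)"
proof -
  have lin: "Vector_Spaces.linear (*s) (*s) f"
    and eq: "f \<circ> hmult H = (hmult H \<circ> tmap f id) + (hmult H \<circ> tmap id f)"
    using assms by (simp_all add: C1_ad_def)
  have "f (hmult H (a \<otimes>\<^sub>v b)) = hmult H (tmap f id (a \<otimes>\<^sub>v b)) + hmult H (tmap id f (a \<otimes>\<^sub>v b))"
    using fun_cong[OF eq, of "a \<otimes>\<^sub>v b"] by simp
  then show ?thesis
    by (simp add: hprod_def tmap_tens[OF lin vec.linear_id] tmap_tens[OF vec.linear_id lin])
qed

lemma C1_ad_coderivation: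
  assumes "f \<in> C1_ad H"
  shows "hcomult H (f y) = tmap f id (hcomult H y) + tmap id f (hcomult H y)"
  using assms by (simp add: C1_ad_def fun_eq_iff)

text \<open>With g in degree 0 and x in degree 1, this map is \<open>a\<close> times the degree. All
  structure maps preserve the grading, hence so does \<open>ad\<close>, and on such maps the degree
  acts by the Leibniz and co-Leibniz rules. The proof checks this in coordinates.\<close>

lemma odd_scaling_in_H1_ad: "odd_scaling a \<in> H1_ad (superline :: ('k::field, sbasis) hopf)"
  unfolding H1_ad_def C1_ad_def D1_def ad_def
  by (auto simp: Vector_Spaces.linear_iff vec.vector_space_axioms fun_eq_iff vec_eq_iff
      split_paired_all all_sbasis superline_comult_nth superline_mult_nth superline_axis
      superline_prod_nth tmap_def tlift_def sum_sbasis tens_def axis_nth algebra_simps)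

text \<open>This bounds all of \<open>C1_ad\<close>; with \<open>odd_scaling_in_H1_ad\<close> it
  shows that \<open>D1\<close> vanishes there.\<close>

lemma C1_ad_superline_eq_odd_scaling:
  assumes two: "(2::'k::field) \<noteq> 0"
    and f: "f \<in> C1_ad (superline :: ('k, sbasis) hopf)"
  shows "f = odd_scaling (f sl_x $ BX)"
proof -
  let ?H = "superline :: ('k, sbasis) hopf"
  have co: "hcomult ?H (f y) $ (i, j) =
      tmap f id (hcomult ?H y) $ (i, j) + tmap id f (hcomult ?H y) $ (i, j)" for y i j
    by (simp add: C1_ad_coderivation[OF f])
  note co_simps = superline_comult_nth superline_axis tmap_def tlift_def sum_sbasis tens_def axis_nth
  have lin: "Vector_Spaces.linear (*s) (*s) f"
    using f by (simp add: C1_ad_def)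
  interpret f: Vector_Spaces.linear "(*s)" "(*s)" f by (rule lin)
  have two_neq_one: "(2::'k) \<noteq> 1"
    by (metis add_cancel_right_right one_add_one zero_neq_one)
  \<comment> \<open>Each index pair isolates one coordinate c of the image: c = c + c at
    \<open>(B1, B1)\<close>, and c = 0 at the others. For g the doubled pair is
    \<open>(BG, BG)\<close>.\<close>
  have f_1: "f sl_one = 0"
    using co[of sl_one B1 B1] co[of sl_one BG BG] co[of sl_one BG BX] co[of sl_one BGX BG]
    by (simp add: vec_eq_iff all_sbasis co_simps two_neq_one)
  have f_g: "f sl_g = 0"
    using co[of sl_g B1 B1] co[of sl_g BG BG] co[of sl_g BX B1] co[of sl_g B1 BGX]
    by (simp add: vec_eq_iff all_sbasis co_simps two_neq_one)
  \<comment> \<open>Now \<Delta>(f x) = f x \<otimes> 1 + g \<otimes> f x, which has no term gx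
    \<otimes> g.\<close>
  have x_gx: "f sl_x $ BGX = 0"
    using co[of sl_x BGX BG] by (simp add: co_simps f_g f_1)
  have gx: "f sl_gx = hprod ?H sl_g (f sl_x)" and xg: "- f sl_gx = hprod ?H (f sl_x) sl_g"
    using C1_ad_derivation[OF f, of sl_g sl_x] C1_ad_derivation[OF f, of sl_x sl_g]
    by (simp_all add: superline_axis f_g f.neg vec_eq_iff all_sbasis superline_prod_nth)
  have "hprod ?H sl_g (f sl_x) + hprod ?H (f sl_x) sl_g = 0"
    using gx xg by (metis add.right_inverse)
  \<comment> \<open>The element g anticommutes with x and gx, so the odd part cancels; it commutes
    with 1 and g, so the even part is doubled.\<close>
  then have "f sl_x $ BG + f sl_x $ BG = 0" "f sl_x $ B1 + f sl_x $ B1 = 0"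
    by (simp_all add: vec_eq_iff all_sbasis superline_prod_nth axis_nth)
  then have even: "f sl_x $ BG = 0" "f sl_x $ B1 = 0"
    using two by (metis mult_2 mult_eq_0_iff)+
  have "f v = odd_scaling (f sl_x $ BX) v" for v
    by (subst linear_basis_expansion[OF lin])
      (simp add: sum_sbasis f_1 f_g gx vec_eq_iff all_sbasis superline_prod_nth axis_nth even x_gx)
  then show ?thesis by blast
qed

theorem proposition5p12:
  assumes "(2::'k::field) \<noteq> 0"
  shows "vs_iso_on hom_scale (H1_ad (superline :: ('k, sbasis) hopf)) (*) (UNIV :: 'k set)"
proof -
  let ?H = "superline :: ('k, sbasis) hopf"
  \<comment> \<open>The isomorphism reads off the eigenvalue of f at x.\<close>
  have "bij_betw (\<lambda>f. f sl_x $ BX) (H1_ad ?H) UNIV"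
  proof (rule bij_betw_byWitness[where f' = odd_scaling])
    show "\<forall>f\<in>H1_ad ?H. odd_scaling (f sl_x $ BX) = f"
      using C1_ad_superline_eq_odd_scaling[OF assms] by (force simp: H1_ad_def)
    show "\<forall>a\<in>UNIV. odd_scaling a sl_x $ BX = (a :: 'k)"
      by (simp add: axis_nth)
  qed (use odd_scaling_in_H1_ad in auto)
  then show ?thesis
    unfolding vs_iso_on_def by (intro exI conjI) (auto simp: hom_scale_def)
qed

end
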